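(* Let $H$ be an $r$-uniform hypergraph on $n$ vertices and $p$ an integer with $1\le p\le r-1$. Then $f(H,p,1)\ge \binom{n}{p}-b(H,p)$, and equality holds for $p=1$ and for $p=r-1$.
   Context: An orientation $D$ of $H$ assigns to each edge a linear ordering of its $r$ vertices (positions $1,\dots,r$). Let $P_1,\dots,P_{\binom rp}$ be the $p$-subsets of $\{1,\dots,r\}$. For a $p$-set $A\subseteq V(H)$, $d_i(A)$ is the number of edges $E\supseteq A$ in whose ordering the set of positions occupied by $A$ is exactly $P_i$. $f(D,p,k)$ is the number of $p$-sets $A$ with $d_i(A)\ge k$ for all $1\le i\le\binom rp$, and $f(H,p,k)$ is its minimum over all orientations $D$. An edge $E$ is $p$-monochromatic (under a coloring of $p$-sets) if all $p$-subsets of $E$ get the same color. $b(H,p)$ is the maximum size of a family $B$ of $p$-subsets of $V(H)$ that can be colored with at most $\binom rp$ colors so that no edge of $H$ all of whose $p$-subsets lie in $B$ is $p$-monochromatic. *)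

theory Defs
  imports Main "HOL-Library.Ramsey"
begin

text \<open>
  Here \<open>nsets V p\<close>, the library's set of \<open>p\<close>-element subsets of \<open>V\<close>, is used
  both for vertex sets and for sets of positions.
\<close>

definition uniform_hypergraph :: "'a set \<Rightarrow> 'a set set \<Rightarrow> nat \<Rightarrow> bool" where
  "uniform_hypergraph V E r \<longleftrightarrow> finite V \<and> E \<subseteq> nsets V r"

text \<open>
  A linear ordering of the vertices of an edge \<open>e\<close> is given by the map \<open>D e\<close> sending each
  vertex of \<open>e\<close> to its position in \<open>{1..r}\<close>. The values of \<open>D e\<close> outside \<open>e\<close>, and of \<open>D\<close>
  outside \<open>E\<close>, are irrelevant to everything below.
\<close>

definition orientation :: "'a set set \<Rightarrow> nat \<Rightarrow> ('a set \<Rightarrow> 'a \<Rightarrow> nat) \<Rightarrow> bool" where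
  "orientation E r D \<longleftrightarrow> (\<forall>e\<in>E. bij_betw (D e) e {1..r})"

text \<open>
  The numbers \<open>d\<^sub>i(A)\<close> are indexed directly by the position sets \<open>P = P\<^sub>i\<close>
  instead of by an enumeration of them.
\<close>

definition pos_degree ::
    "'a set set \<Rightarrow> ('a set \<Rightarrow> 'a \<Rightarrow> nat) \<Rightarrow> nat set \<Rightarrow> 'a set \<Rightarrow> nat" where
  "pos_degree E D P A = card {e \<in> E. A \<subseteq> e \<and> D e ` A = P}"

definition f_orient ::
    "'a set \<Rightarrow> 'a set set \<Rightarrow> nat \<Rightarrow> ('a set \<Rightarrow> 'a \<Rightarrow> nat) \<Rightarrow> nat \<Rightarrow> nat \<Rightarrow> nat" where
  "f_orient V E r D p k =
     card {A \<in> nsets V p. \<forall>P \<in> nsets {1..r} p. k \<le> pos_degree E D P A}"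

definition f_min :: "'a set \<Rightarrow> 'a set set \<Rightarrow> nat \<Rightarrow> nat \<Rightarrow> nat \<Rightarrow> nat" where
  "f_min V E r p k = Min {f_orient V E r D p k | D. orientation E r D}"

definition monochromatic :: "nat \<Rightarrow> ('a set \<Rightarrow> 'c) \<Rightarrow> 'a set \<Rightarrow> bool" where
  "monochromatic p c e \<longleftrightarrow> (\<forall>A \<in> nsets e p. \<forall>A' \<in> nsets e p. c A = c A')"

definition good_family :: "'a set \<Rightarrow> 'a set set \<Rightarrow> nat \<Rightarrow> nat \<Rightarrow> 'a set set \<Rightarrow> bool" where
  "good_family V E r p B \<longleftrightarrow> B \<subseteq> nsets V p \<and>
     (\<exists>c :: 'a set \<Rightarrow> nat. c ` B \<subseteq> {1..r choose p} \<and>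
        (\<forall>e\<in>E. nsets e p \<subseteq> B \<longrightarrow> \<not> monochromatic p c e))"

definition b_max :: "'a set \<Rightarrow> 'a set set \<Rightarrow> nat \<Rightarrow> nat \<Rightarrow> nat" where
  "b_max V E r p = Max {card B | B. good_family V E r p B}"

text \<open>The minimum and the maximum above are taken over finite nonempty sets.\<close>

lemma f_min_set:
  assumes "uniform_hypergraph V E r"
  shows "finite {f_orient V E r D p k | D. orientation E r D}"
    and "{f_orient V E r D p k | D. orientation E r D} \<noteq> {}"
proof -
  have fin: "finite (nsets V p)"
    using assms by (simp add: uniform_hypergraph_def finite_imp_finite_nsets)
  have "f_orient V E r D p k \<le> card (nsets V p)" for D
    unfolding f_orient_def by (rule card_mono[OF fin]) auto
  then show "finite {f_orient V E r D p k | D. orientation E r D}"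
    by (intro finite_subset[OF _ finite_atMost[of "card (nsets V p)"]]) auto
  have "\<forall>e\<in>E. \<exists>h. bij_betw h e {1..r}"
    using assms
    by (auto simp: uniform_hypergraph_def nsets_def intro!: finite_same_card_bij)
  then obtain D where "\<forall>e\<in>E. bij_betw (D e) e {1..r}"
    by metis
  then show "{f_orient V E r D p k | D. orientation E r D} \<noteq> {}"
    unfolding orientation_def by blast
qed

lemma b_max_set:
  assumes "uniform_hypergraph V E r" "p \<le> r"
  shows "finite {card B | B. good_family V E r p B}"
    and "{card B | B. good_family V E r p B} \<noteq> {}"
proof -
  have fin: "finite (nsets V p)"
    using assms by (simp add: uniform_hypergraph_def finite_imp_finite_nsets)
  have "{card B | B. good_family V E r p B} \<subseteq> card ` Pow (nsets V p)"
    unfolding good_family_def by blast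
  then show "finite {card B | B. good_family V E r p B}"
    using fin by (meson finite_Pow_iff finite_imageI finite_subset)
  have "nsets e p \<noteq> {}" if "e \<in> E" for e
    using that assms
    by (auto simp: uniform_hypergraph_def nsets_eq_empty_iff dest!: subsetD)
       (auto simp: nsets_def)
  then have "good_family V E r p {}"
    by (auto simp: good_family_def)
  then show "{card B | B. good_family V E r p B} \<noteq> {}"
    by blast
qed

end

theory Submission
  imports Defs "HOL-Combinatorics.Transposition"
begin

text \<open>
  For an orientation \<open>D\<close>, give each \<open>p\<close>-set \<open>A\<close> that is not counted by \<open>f\<close> a position set \<open>P\<close>
  with \<open>d\<^sub>P(A) = 0\<close> as its colour. An edge cannot be monochromatic of colour \<open>P\<close>, because its
  subset occupying the positions \<open>P\<close> has positive degree; so the uncounted sets form a good family.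

  Conversely, a coloured good family \<open>B\<close> yields an orientation under which no set of \<open>B\<close> is counted,
  provided every edge can be ordered so that none of its subsets in \<open>B\<close> occupies the positions
  named by its colour. For \<open>p = 1\<close> and \<open>p = r - 1\<close> (passing to complements) the \<open>p\<close>-subsets of an
  edge are indexed by its vertices, and each vertex has at most one forbidden position. Such an
  ordering exists unless all vertices forbid the same position, i.e. unless the edge is
  monochromatic.
\<close>

section \<open>Ordering one edge under forbidden positions\<close>

text \<open>Take a bijection with the fewest violations. A violation \<open>h v = F v\<close> is removed without creating
  another by swapping \<open>v\<close> with some \<open>w\<close> whose forbidden value differs from \<open>h v\<close>.\<close>

lemma ex_bij_betw_avoiding:
  assumes "finite e" and "bij_betw h0 e Q"
    and nonconst: "\<And>q. q \<in> Q \<Longrightarrow> \<exists>w\<in>e. F w \<noteq> q"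
  shows "\<exists>h. bij_betw h e Q \<and> (\<forall>v\<in>e. h v \<noteq> F v)"
proof -
  define bad where "bad h = {v \<in> e. h v = F v}" for h
  obtain h where h: "bij_betw h e Q"
    and least: "\<And>h'. bij_betw h' e Q \<Longrightarrow> card (bad h) \<le> card (bad h')"
    using ex_has_least_nat[of "\<lambda>h. bij_betw h e Q" h0 "\<lambda>h. card (bad h)"] assms(2) by blast
  have "h v \<noteq> F v" if v: "v \<in> e" for v
  proof
    assume eq: "h v = F v"
    have "h v \<in> Q"
      using h v by (simp add: bij_betwE)
    then obtain w where w: "w \<in> e" "F w \<noteq> h v"
      using nonconst by blast
    \<comment> \<open>\<open>w\<close> differs from \<open>v\<close>, because \<open>F v\<close>
      equals \<open>h v\<close> and \<open>F w\<close> does not. Injectivity of \<open>h\<close>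
      then keeps the value that \<open>v\<close> receives in the swap away from
      \<open>F v\<close>.\<close>
    then have "h w \<noteq> F v"
      using eq h v unfolding bij_betw_def by (metis inj_onD)
    define h' where "h' = h \<circ> transpose v w"
    have "bij_betw (transpose v w) e e"
      using v w by (simp add: bij_betw_transpose_iff)
    then have "bij_betw h' e Q"
      unfolding h'_def using h by (rule bij_betw_trans)
    moreover have "bad h' \<subset> bad h"
      using v w eq \<open>h w \<noteq> F v\<close> by (auto simp: bad_def h'_def transpose_def split: if_splits)
    ultimately show False
      using least[of h'] psubset_card_mono[of "bad h" "bad h'"] \<open>finite e\<close>
      by (auto simp: bad_def)
  qed
  then show ?thesis
    using h by blast
qed

lemma nsets_card_minus_one:
  assumes "finite X" and "card X = Suc m"
  shows "nsets X m = (\<lambda>x. X - {x}) ` X"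
proof
  show "nsets X m \<subseteq> (\<lambda>x. X - {x}) ` X"
  proof
    fix A assume A: "A \<in> nsets X m"
    then have "card (X - A) = 1"
      using assms by (simp add: nsets_def card_Diff_subset)
    then obtain x where "X - A = {x}"
      by (rule card_1_singletonE)
    then have "x \<in> X" and "A = X - {x}"
      using A by (auto simp: nsets_def)
    then show "A \<in> (\<lambda>x. X - {x}) ` X"
      by blast
  qed
  show "(\<lambda>x. X - {x}) ` X \<subseteq> nsets X m"
    using assms by (auto simp: nsets_def)
qed

text \<open>Treats both values of \<open>p\<close> at once: \<open>s\<close> indexes the
  \<open>p\<close>-subsets of the edge by its vertices, \<open>t\<close> the position sets by
  positions, and orderings respect the indexing. Avoiding the position set \<open>C (s v)\<close>
  thus means that \<open>v\<close> avoids a single position.\<close>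

lemma ex_edge_ordering_indexed:
  assumes "finite e" and "card e = r"
    and C: "\<And>A. A \<in> B \<Longrightarrow> C A \<in> nsets {1..r} p"
    and nonmono: "nsets e p \<subseteq> B \<Longrightarrow> \<exists>A\<in>nsets e p. \<exists>A'\<in>nsets e p. C A \<noteq> C A'"
    and s: "nsets e p = s ` e"
    and t: "nsets {1..r} p = t ` {1..r}" "inj_on t {1..r}"
    and st: "\<And>h v. bij_betw h e {1..r} \<Longrightarrow> v \<in> e \<Longrightarrow> h ` s v = t (h v)"
  shows "\<exists>h. bij_betw h e {1..r} \<and> (\<forall>A\<in>nsets e p \<inter> B. h ` A \<noteq> C A)"
proof -
  \<comment> \<open>\<open>0\<close> is not a position, so it forbids nothing.\<close>
  define F where "F v = (if s v \<in> B then inv_into {1..r} t (C (s v)) else 0)" for v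
  have tF: "t (F v) = C (s v)" if "s v \<in> B" for v
    using that C[OF that] t(1) by (simp add: F_def f_inv_into_f)
  obtain h0 where h0: "bij_betw h0 e {1..r}"
    using finite_same_card_bij[of e "{1..r}"] assms(1,2) by auto
  \<comment> \<open>If every vertex forbade \<open>q\<close>, then, as \<open>q\<close> is not
    \<open>0\<close>, all \<open>p\<close>-subsets of the edge would lie in \<open>B\<close> with
    the same value \<open>t q\<close> of \<open>C\<close>, against \<open>nonmono\<close>.\<close>
  have "\<exists>w\<in>e. F w \<noteq> q" if q: "q \<in> {1..r}" for q
  proof (rule ccontr)
    assume "\<not> ?thesis"
    then have F: "F w = q" if "w \<in> e" for w
      using that by blast
    have B: "s w \<in> B" if "w \<in> e" for w
      using F[OF that] q by (auto simp: F_def split: if_splits)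
    then have "C (s w) = t q" if "w \<in> e" for w
      using tF that F by metis
    then show False
      using nonmono B s by auto
  qed
  from ex_bij_betw_avoiding[OF assms(1) h0 this]
  obtain h where h: "bij_betw h e {1..r}" and avoid: "\<forall>v\<in>e. h v \<noteq> F v"
    by blast
  have "h ` s v \<noteq> C (s v)" if v: "v \<in> e" and "s v \<in> B" for v
  proof
    assume "h ` s v = C (s v)"
    then have "h v = inv_into {1..r} t (C (s v))"
      using st[OF h v] t(2) bij_betwE[OF h] v by (metis inv_into_f_f)
    then show False
      using bspec[OF avoid v] \<open>s v \<in> B\<close> by (simp add: F_def)
  qed
  then show ?thesis
    using h s by auto
qed

lemma ex_edge_ordering:
  assumes "finite e" and "card e = r" and "1 \<le> p" and "p \<le> r - 1"
    and "p = 1 \<or> p = r - 1"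
    and C: "\<And>A. A \<in> B \<Longrightarrow> C A \<in> nsets {1..r} p"
    and nonmono: "nsets e p \<subseteq> B \<Longrightarrow> \<exists>A\<in>nsets e p. \<exists>A'\<in>nsets e p. C A \<noteq> C A'"
  shows "\<exists>h. bij_betw h e {1..r} \<and> (\<forall>A\<in>nsets e p \<inter> B. h ` A \<noteq> C A)"
  using assms(5)
proof
  assume p: "p = 1"
  have single: "nsets X 1 = (\<lambda>x. {x}) ` X" for X :: "'x set"
    by (auto simp: nsets_def card_1_singleton_iff)
  show ?thesis
    by (rule ex_edge_ordering_indexed[where s = "\<lambda>v. {v}" and t = "\<lambda>q. {q}"])
       (use assms p single in auto)
next
  assume p: "p = r - 1"
  with assms have r: "r = Suc p"
    by simp
  show ?thesis
  proof (rule ex_edge_ordering_indexed[where s = "\<lambda>v. e - {v}" and t = "\<lambda>q. {1..r} - {q}"])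
    show "nsets e p = (\<lambda>v. e - {v}) ` e"
      using nsets_card_minus_one assms r by blast
    show "nsets {1..r} p = (\<lambda>q. {1..r} - {q}) ` {1..r}"
      using r by (intro nsets_card_minus_one) auto
    show "inj_on (\<lambda>q. {1..r} - {q}) {1..r}"
      by (rule inj_onI) blast
    show "h ` (e - {v}) = {1..r} - {h v}" if "bij_betw h e {1..r}" "v \<in> e" for h v
      using that by (auto simp: bij_betw_def dest: inj_onD)
  qed (use assms in auto)
qed

section \<open>Uncounted sets and good families\<close>

text \<open>The colours of a good family are numbers; \<open>\<phi>\<close> translates them into
  position sets.\<close>

lemma ex_position_colours:
  obtains \<phi> where "bij_betw \<phi> {1..r choose p} (nsets {1..r} p)"
  using finite_same_card_bij[of "{1..r choose p}" "nsets {1..r} p"]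
  by (auto simp: card_nsets finite_imp_finite_nsets)

context
  fixes V :: "'a set" and E :: "'a set set" and r p :: nat
  assumes H: "uniform_hypergraph V E r"
begin

lemma finite_vertices: "finite V"
  using H by (simp add: uniform_hypergraph_def)

lemma finite_edges: "finite E"
  using H by (meson finite_imp_finite_nsets finite_subset uniform_hypergraph_def)

lemma edgeD:
  assumes "e \<in> E"
  shows "e \<subseteq> V" and "finite e" and "card e = r"
  using H assms by (auto simp: uniform_hypergraph_def nsets_def)

lemma f_orient_conv_missing:
  "f_orient V E r D p 1 =
     (card V choose p)
       - card {A \<in> nsets V p. \<exists>P\<in>nsets {1..r} p. pos_degree E D P A = 0}"
proof -
  let ?M = "{A \<in> nsets V p. \<exists>P\<in>nsets {1..r} p. pos_degree E D P A = 0}"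
  have "{A \<in> nsets V p. \<forall>P\<in>nsets {1..r} p. 1 \<le> pos_degree E D P A} = nsets V p - ?M"
    by (auto simp: Suc_le_eq)
  moreover have "finite ?M"
    using finite_vertices by (simp add: finite_imp_finite_nsets)
  ultimately show ?thesis
    by (simp add: f_orient_def card_Diff_subset card_nsets)
qed

lemma good_family_missing:
  assumes D: "orientation E r D" and "p \<le> r"
  shows "good_family V E r p {A \<in> nsets V p. \<exists>P\<in>nsets {1..r} p. pos_degree E D P A = 0}"
    (is "good_family V E r p ?M")
proof -
  obtain \<phi> where \<phi>: "bij_betw \<phi> {1..r choose p} (nsets {1..r} p)"
    by (rule ex_position_colours)
  have "\<forall>A\<in>?M. \<exists>i. i \<in> {1..r choose p} \<and> pos_degree E D (\<phi> i) A = 0"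
  proof
    fix A assume "A \<in> ?M"
    then obtain P where "P \<in> nsets {1..r} p" and "pos_degree E D P A = 0"
      by blast
    then show "\<exists>i. i \<in> {1..r choose p} \<and> pos_degree E D (\<phi> i) A = 0"
      unfolding bij_betw_imp_surj_on[OF \<phi>, symmetric] by blast
  qed
  from bchoice[OF this]
  obtain c where c: "\<forall>A\<in>?M. c A \<in> {1..r choose p} \<and> pos_degree E D (\<phi> (c A)) A = 0" ..
  have "\<not> monochromatic p c e" if e: "e \<in> E" and sub: "nsets e p \<subseteq> ?M" for e
  proof
    assume mono: "monochromatic p c e"
    have h: "bij_betw (D e) e {1..r}"
      using D e by (simp add: orientation_def)
    have "nsets e p \<noteq> {}"
      using edgeD[OF e] \<open>p \<le> r\<close> by (auto simp: nsets_eq_empty_iff)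
    then obtain A0 where A0: "A0 \<in> nsets e p"
      by blast
    define P where "P = \<phi> (c A0)"
    have "c A0 \<in> {1..r choose p}"
      using A0 sub c by blast
    then have P: "P \<in> nsets {1..r} p"
      unfolding P_def by (rule bij_betw_apply[OF \<phi>])
    \<comment> \<open>The \<open>p\<close>-subset of \<open>e\<close> that occupies the positions
      \<open>P\<close>. By monochromaticity its colour names \<open>P\<close>, so its degree there
      is \<open>0\<close>, yet \<open>e\<close> itself is counted in that degree.\<close>
    define A where "A = inv_into e (D e) ` P"
    have DA: "D e ` A = P"
      using P h unfolding A_def by (auto simp: nsets_def bij_betw_def image_inv_into_cancel)
    have "bij_betw (inv_into e (D e)) {1..r} e"
      using h by (rule bij_betw_inv_into)
    then have A: "A \<in> nsets e p"
      using P unfolding A_def nsets_def bij_betw_def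
      by (auto simp: card_image inj_on_subset)
    have "c A = c A0"
      using mono A A0 unfolding monochromatic_def by blast
    moreover have "pos_degree E D (\<phi> (c A)) A = 0"
      using c sub A by blast
    ultimately have "pos_degree E D P A = 0"
      by (simp add: P_def)
    moreover have "e \<in> {e \<in> E. A \<subseteq> e \<and> D e ` A = P}"
      using e A DA by (auto simp: nsets_def)
    ultimately show False
      using finite_edges by (auto simp: pos_degree_def)
  qed
  moreover have "c ` ?M \<subseteq> {1..r choose p}"
    using c by blast
  ultimately show ?thesis
    unfolding good_family_def by (intro conjI exI[of _ c]) auto
qed

text \<open>The uncounted sets form a good family, so there are at most \<open>b_max V E r p\<close>
  of them.\<close>

lemma f_orient_lower:
  assumes "orientation E r D" and "p \<le> r"
  shows "(card V choose p) - b_max V E r p \<le> f_orient V E r D p 1"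
proof -
  have "card {A \<in> nsets V p. \<exists>P\<in>nsets {1..r} p. pos_degree E D P A = 0} \<le> b_max V E r p"
    unfolding b_max_def
    by (rule Max_ge[OF b_max_set(1)[OF H assms(2)]]) (use good_family_missing[OF assms] in blast)
  then show ?thesis
    unfolding f_orient_conv_missing by linarith
qed

lemma ex_orientation_avoiding_good_family:
  assumes "1 \<le> p" and "p \<le> r - 1" and "p = 1 \<or> p = r - 1" and B: "good_family V E r p B"
  obtains D where "orientation E r D"
    and "B \<subseteq> {A \<in> nsets V p. \<exists>P\<in>nsets {1..r} p. pos_degree E D P A = 0}"
proof -
  obtain \<phi> where \<phi>: "bij_betw \<phi> {1..r choose p} (nsets {1..r} p)"
    by (rule ex_position_colours)
  obtain c where c: "c ` B \<subseteq> {1..r choose p}"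
    and nonmono: "\<forall>e\<in>E. nsets e p \<subseteq> B \<longrightarrow> \<not> monochromatic p c e"
    using B unfolding good_family_def by (elim conjE exE)
  have C: "\<phi> (c A) \<in> nsets {1..r} p" if "A \<in> B" for A
    using c that by (intro bij_betw_apply[OF \<phi>]) blast
  \<comment> \<open>The colour of a set names the positions it must not occupy. This constrains each
    edge separately, so the edges can be ordered independently.\<close>
  have "\<exists>h. bij_betw h e {1..r} \<and> (\<forall>A\<in>nsets e p \<inter> B. h ` A \<noteq> \<phi> (c A))" if e: "e \<in> E" for e
  proof (rule ex_edge_ordering[OF edgeD(2,3)[OF e] assms(1-3) C])
    assume sub: "nsets e p \<subseteq> B"
    then obtain A A' where A: "A \<in> nsets e p" "A' \<in> nsets e p" "c A \<noteq> c A'"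
      using bspec[OF nonmono e] unfolding monochromatic_def by blast
    then have "\<phi> (c A) \<noteq> \<phi> (c A')"
      using \<phi> c sub unfolding bij_betw_def by (metis image_subset_iff inj_onD subsetD)
    then show "\<exists>A\<in>nsets e p. \<exists>A'\<in>nsets e p. \<phi> (c A) \<noteq> \<phi> (c A')"
      using A by blast
  qed
  then obtain D where D: "\<And>e. e \<in> E \<Longrightarrow> bij_betw (D e) e {1..r}"
    and avoid: "\<And>e A. e \<in> E \<Longrightarrow> A \<in> nsets e p \<inter> B \<Longrightarrow> D e ` A \<noteq> \<phi> (c A)"
    by metis
  have BV: "B \<subseteq> nsets V p"
    using B by (simp add: good_family_def)
  have "pos_degree E D (\<phi> (c A)) A = 0" if A: "A \<in> B" for A
  proof -
    have "D e ` A \<noteq> \<phi> (c A)" if "e \<in> E" "A \<subseteq> e" for e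
      using avoid[OF that(1), of A] that A BV by (auto simp: nsets_def)
    then have "{e \<in> E. A \<subseteq> e \<and> D e ` A = \<phi> (c A)} = {}"
      by blast
    then show ?thesis
      by (simp only: pos_degree_def card.empty)
  qed
  then have "B \<subseteq> {A \<in> nsets V p. \<exists>P\<in>nsets {1..r} p. pos_degree E D P A = 0}"
    using BV C by blast
  moreover have "orientation E r D"
    using D by (simp add: orientation_def)
  ultimately show ?thesis
    using that by blast
qed

section \<open>Passing to the extremal values\<close>

lemma b_max_attained:
  assumes "p \<le> r"
  obtains B where "good_family V E r p B" and "card B = b_max V E r p"
  using Max_in[OF b_max_set[OF H assms]] unfolding b_max_def by auto

text \<open>Makes the truncated difference of naturals agree with the integer difference in the
  theorem.\<close>

lemma b_max_le:
  assumes "p \<le> r"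
  shows "b_max V E r p \<le> card V choose p"
proof -
  obtain B where "good_family V E r p B" "card B = b_max V E r p"
    using b_max_attained[OF assms] .
  then show ?thesis
    using card_mono[of "nsets V p" B] finite_vertices
    by (simp add: good_family_def finite_imp_finite_nsets card_nsets)
qed

lemma f_min_lower:
  assumes "p \<le> r"
  shows "(card V choose p) - b_max V E r p \<le> f_min V E r p 1"
  unfolding f_min_def
  using f_orient_lower assms by (subst Min_ge_iff[OF f_min_set[OF H]]) blast

text \<open>An orientation built from a good family of maximum size leaves at least
  \<open>b_max V E r p\<close> sets uncounted.\<close>

lemma f_min_upper:
  assumes "1 \<le> p" and "p \<le> r - 1" and "p = 1 \<or> p = r - 1"
  shows "f_min V E r p 1 \<le> (card V choose p) - b_max V E r p"
proof -
  obtain B where B: "good_family V E r p B" and card: "card B = b_max V E r p"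
    using b_max_attained assms(2) by (metis diff_le_self le_trans)
  obtain D where D: "orientation E r D"
    and sub: "B \<subseteq> {A \<in> nsets V p. \<exists>P\<in>nsets {1..r} p. pos_degree E D P A = 0}" (is "B \<subseteq> ?M")
    using ex_orientation_avoiding_good_family[OF assms B] .
  have "card B \<le> card ?M"
    using sub finite_vertices by (intro card_mono) (auto simp: finite_imp_finite_nsets)
  then have "f_orient V E r D p 1 \<le> (card V choose p) - b_max V E r p"
    unfolding f_orient_conv_missing card[symmetric] by (rule diff_le_mono2)
  moreover have "f_min V E r p 1 \<le> f_orient V E r D p 1"
    unfolding f_min_def by (rule Min_le[OF f_min_set(1)[OF H]]) (use D in blast)
  ultimately show ?thesis
    by linarith
qed

end

theorem theorem11:
  fixes V :: "'a set" and E :: "'a set set" and r n p :: nat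
  assumes "uniform_hypergraph V E r" and "card V = n"
    and "1 \<le> p" and "p \<le> r - 1"
  shows "int (f_min V E r p 1) \<ge> int (n choose p) - int (b_max V E r p)
    \<and> (p = 1 \<or> p = r - 1 \<longrightarrow>
         int (f_min V E r p 1) = int (n choose p) - int (b_max V E r p))"
proof -
  have "p \<le> r"
    using assms(4) by simp
  then show ?thesis
    using f_min_lower[OF assms(1), of p] f_min_upper[OF assms(1,3,4)] b_max_le[OF assms(1), of p]
      assms(2)
    by auto
qed

end
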